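(* For every integer $n\ge1$, $\textsc{bm}(n,n,n)=\lceil n/2\rceil$.
   Context: A hypergraph is identified with its finite edge set; a matching is a set of pairwise disjoint edges. A hypergraph $H$ is $k$-partite with sides $V_1,\ldots,V_k$ (a fixed partition of its vertex set) if $|e\cap V_t|=1$ for every edge $e$ and every $t$. For $f:H\to\mathbb{R}_{\ge0}$, $\deg_f(v)=\sum_{e\ni v}f(e)$; $f$ is balanced if $\deg_f$ is constant on each side. $H$ is $(b_1,\ldots,b_k)$-fractionally balanced if it is $k$-partite with sides of sizes $b_1,\ldots,b_k$ and has a nonzero balanced $f:H\to\mathbb{R}_{\ge0}$. $\textsc{bm}(b_1,\ldots,b_k)$ is the largest $m$ such that every $(b_1,\ldots,b_k)$-fractionally balanced $k$-partite hypergraph has a matching of size $m$. *)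

theory Defs
  imports Complex_Main "HOL-Library.Disjoint_Sets"
begin

definition k_partite :: "'a set list \<Rightarrow> 'a set set \<Rightarrow> bool" where
  "k_partite Vs H \<longleftrightarrow>
     finite H \<and> (\<forall>V\<in>set Vs. finite V) \<and>
     disjoint_family_on (\<lambda>t. Vs ! t) {..<length Vs} \<and>
     (\<forall>e\<in>H. e \<subseteq> \<Union>(set Vs) \<and> (\<forall>t<length Vs. card (e \<inter> Vs ! t) = 1))"

definition is_matching :: "'a set set \<Rightarrow> 'a set set \<Rightarrow> bool" where
  "is_matching H M \<longleftrightarrow> M \<subseteq> H \<and> disjoint M"

definition deg :: "'a set set \<Rightarrow> ('a set \<Rightarrow> real) \<Rightarrow> 'a \<Rightarrow> real" where
  "deg H f v = (\<Sum>e\<in>{e\<in>H. v \<in> e}. f e)"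

definition balanced :: "'a set list \<Rightarrow> 'a set set \<Rightarrow> ('a set \<Rightarrow> real) \<Rightarrow> bool" where
  "balanced Vs H f \<longleftrightarrow> (\<forall>V\<in>set Vs. \<forall>u\<in>V. \<forall>v\<in>V. deg H f u = deg H f v)"

text \<open>Only the values of \<open>f\<close> on \<open>H\<close> matter, so a function on \<open>H\<close> is represented by a total function.\<close>

definition fractionally_balanced :: "nat list \<Rightarrow> 'a set list \<Rightarrow> 'a set set \<Rightarrow> bool" where
  "fractionally_balanced bs Vs H \<longleftrightarrow>
     k_partite Vs H \<and> map card Vs = bs \<and>
     (\<exists>f. (\<forall>e\<in>H. 0 \<le> f e) \<and> (\<exists>e\<in>H. f e \<noteq> 0) \<and> balanced Vs H f)"

text \<open>Since a definition cannot quantify over types, the vertices are taken to be natural numbers.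
  This loses no generality, as the vertex set is finite; see \<open>matching_transfer\<close>.\<close>

definition bm :: "nat list \<Rightarrow> nat" where
  "bm bs = (GREATEST m. \<forall>(Vs :: nat set list) H. fractionally_balanced bs Vs H \<longrightarrow>
                          (\<exists>M. is_matching H M \<and> card M = m))"

lemma matching_transfer:
  fixes Vs :: "'a set list"
  assumes all: "\<And>(Ws :: nat set list) G. fractionally_balanced bs Ws G \<Longrightarrow>
                  \<exists>M. is_matching G M \<and> card M = m"
    and fb: "fractionally_balanced bs Vs H"
  shows "\<exists>M. is_matching H M \<and> card M = m"
proof -
  define U where "U = \<Union>(set Vs)"
  have kp: "k_partite Vs H" and cs: "map card Vs = bs"
    using fb by (auto simp: fractionally_balanced_def)
  obtain f where f: "\<forall>e\<in>H. 0 \<le> f e" "\<exists>e\<in>H. f e \<noteq> 0" "balanced Vs H f"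
    using fb by (auto simp: fractionally_balanced_def)
  have "finite U" using kp by (auto simp: U_def k_partite_def)
  then obtain g :: "'a \<Rightarrow> nat" where g: "inj_on g U"
    using finite_imp_inj_to_nat_seg by blast
  have HU: "e \<subseteq> U" if "e \<in> H" for e using kp that by (auto simp: U_def k_partite_def)
  have VU: "V \<subseteq> U" if "V \<in> set Vs" for V using that by (auto simp: U_def)
  have injH: "inj_on ((`) g) H"
    using inj_on_image_Pow[OF g] by (rule inj_on_subset) (use HU in auto)
  have int: "g ` A \<inter> g ` B = g ` (A \<inter> B)" if "A \<subseteq> U" "B \<subseteq> U" for A B
    using inj_on_image_Int[OF g that] by simp
  have crd: "card (g ` A) = card A" if "A \<subseteq> U" for A
    using card_image inj_on_subset[OF g that] by blast
  define Ws where "Ws = map ((`) g) Vs"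
  define G where "G = (`) g ` H"
  define f' where "f' = f \<circ> the_inv_into H ((`) g)"
  have f': "f' (g ` e) = f e" if "e \<in> H" for e
    using the_inv_into_f_f[OF injH that] by (simp add: f'_def)
  have "k_partite Ws G"
    unfolding k_partite_def
  proof (intro conjI ballI allI impI)
    show "finite G" using kp by (simp add: k_partite_def G_def)
    show "finite V" if "V \<in> set Ws" for V using that kp by (auto simp: k_partite_def Ws_def)
    show "disjoint_family_on (\<lambda>t. Ws ! t) {..<length Ws}"
      using kp by (auto simp: disjoint_family_on_def k_partite_def Ws_def int VU)
    show "e \<subseteq> \<Union>(set Ws)" if "e \<in> G" for e
      using that kp by (fastforce simp: k_partite_def Ws_def G_def)
    show "card (e \<inter> Ws ! t) = 1" if "e \<in> G" "t < length Ws" for e t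
    proof -
      obtain e0 where e0: "e0 \<in> H" "e = g ` e0" using \<open>e \<in> G\<close> by (auto simp: G_def)
      have t: "t < length Vs" using that by (simp add: Ws_def)
      have "card (e \<inter> Ws ! t) = card (g ` (e0 \<inter> Vs ! t))"
        using t e0 by (simp add: Ws_def int HU VU)
      also have "\<dots> = card (e0 \<inter> Vs ! t)" using HU[OF e0(1)] by (intro crd) auto
      finally show ?thesis using kp e0 t by (simp add: k_partite_def)
    qed
  qed
  moreover have "map card Ws = bs"
    using cs crd VU by (auto simp: Ws_def)
  moreover have "balanced Ws G f'"
  proof -
    have "deg G f' (g v) = deg H f v" if "v \<in> U" for v
    proof -
      have "g v \<in> g ` e \<longleftrightarrow> v \<in> e" if "e \<in> H" for e
        using inj_on_image_mem_iff[OF g \<open>v \<in> U\<close> HU[OF that]] .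
      then have "{e\<in>G. g v \<in> e} = (`) g ` {e\<in>H. v \<in> e}"
        unfolding G_def by blast
      then have "deg G f' (g v) = (\<Sum>e\<in>{e\<in>H. v \<in> e}. f' (g ` e))"
        unfolding deg_def
        by (simp add: sum.reindex inj_on_subset[OF injH])
      then show ?thesis using f' by (simp add: deg_def)
    qed
    then have "deg G f' (g u) = deg G f' (g v)" if "V \<in> set Vs" "u \<in> V" "v \<in> V" for V u v
      using f(3) VU[OF that(1)] that by (metis balanced_def subsetD)
    then show ?thesis unfolding balanced_def Ws_def set_map by blast
  qed
  moreover have "(\<forall>e\<in>G. 0 \<le> f' e) \<and> (\<exists>e\<in>G. f' e \<noteq> 0)"
    using f(1,2) f' by (simp add: G_def)
  ultimately have "fractionally_balanced bs Ws G"
    unfolding fractionally_balanced_def by blast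
  then obtain N where N: "is_matching G N" "card N = m" using all by blast
  define M where "M = {e\<in>H. g ` e \<in> N}"
  have NM: "N = (`) g ` M" using N by (auto simp: M_def is_matching_def G_def)
  have MH: "M \<subseteq> H" by (auto simp: M_def)
  have "card M = m" using N NM card_image[OF inj_on_subset[OF injH MH]] by simp
  moreover have "disjoint M"
  proof (rule disjointI)
    fix a b assume ab: "a \<in> M" "b \<in> M" "a \<noteq> b"
    then have "g ` a \<noteq> g ` b" using injH MH by (auto dest: inj_onD)
    then have "g ` a \<inter> g ` b = {}"
      using N ab by (auto simp: M_def is_matching_def disjoint_def)
    then show "a \<inter> b = {}" by auto
  qed
  ultimately show ?thesis using MH by (auto simp: is_matching_def)
qed

end

theory Submission
  imports Defs
begin

text \<open>
  Lower bound: scaling a balanced function to degree 1 everywhere gives a fractional matching of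
  weight \<open>n\<close>, so it suffices that a \<open>k\<close>-partite hypergraph with a fractional matching of weight
  \<open>w\<close> has a matching of size at least \<open>w / (k - 1)\<close> (Furedi's theorem). This is greedy: it is
  enough to find an edge such that the edges meeting it have total weight at most \<open>k - 1\<close>. Suppose
  that there is none, and move \<open>f\<close> to a vertex of the fractional matching polytope without losing
  weight. The edges meeting \<open>e\<close> have total weight at most \<open>k - (k - 1) f(e)\<close>, so \<open>f < 1 / (k - 1)\<close>
  and every saturated vertex lies on at least \<open>k\<close> edges of the support. Double counting shows that
  the support has at least as many edges as there are saturated vertices, with equality only if
  all vertices of the support are saturated; but then the degree equations are dependent, since
  all sides carry the same total weight. In either case the support edges are linearly dependent on
  the saturated vertices, so \<open>f\<close> is not a vertex of the polytope.

  Upper bound: take disjoint copies of the truncated Fano plane, which has two vertices on each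
  side and pairwise intersecting edges, together with a single disjoint edge if \<open>n\<close> is odd.
\<close>

section \<open>Linear systems and the ratio test\<close>

text \<open>Gaussian elimination by induction on the equations: an equation with a nonzero
  coefficient eliminates one unknown, one with only zero coefficients is dropped.\<close>

lemma homogeneous_system_nontrivial_solution:
  fixes a :: "'v \<Rightarrow> 'e \<Rightarrow> 'f::field"
  assumes "finite T" "finite S" "card T < card S"
  shows "\<exists>g. (\<exists>e\<in>S. g e \<noteq> 0) \<and> (\<forall>v\<in>T. (\<Sum>e\<in>S. a v e * g e) = 0)"
  using assms
proof (induction T arbitrary: S a rule: finite_induct)
  case empty
  then obtain e where "e \<in> S" by fastforce
  then show ?case by (intro exI[of _ "\<lambda>_. 1"]) auto
next
  case (insert v T)
  show ?case
  proof (cases "\<forall>e\<in>S. a v e = 0")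
    case True
    from insert.IH[of S a] insert.prems insert.hyps
    obtain g where g: "\<exists>e\<in>S. g e \<noteq> 0" "\<forall>v\<in>T. (\<Sum>e\<in>S. a v e * g e) = 0" by auto
    with True show ?thesis by (intro exI[of _ g]) auto
  next
    case False
    then obtain e0 where e0: "e0 \<in> S" "a v e0 \<noteq> 0" by blast
    define S' where "S' = S - {e0}"
    have S': "finite S'" "card T < card S'"
      using insert.prems insert.hyps e0 by (auto simp: S'_def)
    \<comment> \<open>These coefficients arise from solving equation \<open>v\<close> for the
      unknown \<open>e0\<close> and substituting into the others.\<close>
    from insert.IH[of S' "\<lambda>w e. a w e - a w e0 * a v e / a v e0"] S'
    obtain g where g: "\<exists>e\<in>S'. g e \<noteq> 0"
      "\<forall>w\<in>T. (\<Sum>e\<in>S'. (a w e - a w e0 * a v e / a v e0) * g e) = 0" by blast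
    define x where "x = - (\<Sum>e\<in>S'. a v e * g e) / a v e0"
    define h where "h = g(e0 := x)"
    have split: "(\<Sum>e\<in>S. a w e * h e) = a w e0 * x + (\<Sum>e\<in>S'. a w e * g e)" for w
    proof -
      have "(\<Sum>e\<in>S. a w e * h e) = a w e0 * h e0 + (\<Sum>e\<in>S'. a w e * h e)"
        unfolding S'_def using insert.prems e0 by (intro sum.remove) auto
      also have "(\<Sum>e\<in>S'. a w e * h e) = (\<Sum>e\<in>S'. a w e * g e)"
        by (intro sum.cong) (auto simp: h_def S'_def)
      finally show ?thesis by (simp add: h_def)
    qed
    have "(\<Sum>e\<in>S. a w e * h e) = 0" if "w \<in> T" for w
    proof -
      have "(\<Sum>e\<in>S'. (a w e - a w e0 * a v e / a v e0) * g e)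
          = (\<Sum>e\<in>S'. a w e * g e) - (\<Sum>e\<in>S'. (a w e0 / a v e0) * (a v e * g e))"
        by (simp add: sum_subtractf[symmetric] algebra_simps)
      also have "\<dots> = a w e0 * x + (\<Sum>e\<in>S'. a w e * g e)"
        unfolding sum_distrib_left[symmetric] by (simp add: x_def)
      finally show ?thesis using g(2) that split by simp
    qed
    moreover have "(\<Sum>e\<in>S. a v e * h e) = 0"
      using e0 unfolding split by (simp add: x_def)
    moreover have "\<exists>e\<in>S. h e \<noteq> 0" using g(1) by (auto simp: h_def S'_def)
    ultimately show ?thesis by blast
  qed
qed

text \<open>The ratio test of the simplex method: \<open>s\<close> is the least ratio
  \<open>p i / - q i\<close> over the indices with \<open>q i < 0\<close>. It is positive because,
  by \<open>pq\<close>, coordinates that are already zero do not move.\<close>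

lemma first_vanishing_coordinate:
  fixes p q :: "'i \<Rightarrow> real"
  assumes "finite I" and p: "\<And>i. i \<in> I \<Longrightarrow> 0 \<le> p i"
    and pq: "\<And>i. i \<in> I \<Longrightarrow> p i = 0 \<Longrightarrow> q i = 0"
    and neg: "\<exists>i\<in>I. q i < 0"
  shows "\<exists>s>0. (\<forall>i\<in>I. 0 \<le> p i + s * q i) \<and> (\<exists>i\<in>I. p i \<noteq> 0 \<and> p i + s * q i = 0)"
proof -
  define J where "J = {i\<in>I. q i < 0}"
  have J: "finite J" "J \<noteq> {}" using assms by (auto simp: J_def)
  obtain j where j: "j \<in> J" and jmin: "\<And>i. i \<in> J \<Longrightarrow> p j / - q j \<le> p i / - q i"
    using arg_min_if_finite(1)[OF J, of "\<lambda>i. p i / - q i"]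
      arg_min_least[OF J, of _ "\<lambda>i. p i / - q i"] by blast
  define s where "s = p j / - q j"
  have jI: "j \<in> I" "q j < 0" using j by (auto simp: J_def)
  have pj: "p j > 0" using p[OF jI(1)] pq[OF jI(1)] jI(2) by (cases "p j = 0") auto
  have "s > 0" using pj jI by (simp add: s_def divide_pos_neg)
  moreover have "0 \<le> p i + s * q i" if "i \<in> I" for i
  proof (cases "q i < 0")
    case True
    then have "s \<le> p i / - q i" using jmin that by (auto simp: J_def s_def)
    with True have "s * - q i \<le> p i" by (subst (asm) pos_le_divide_eq) auto
    then show ?thesis by simp
  next
    case False
    then show ?thesis using p[OF that] \<open>s > 0\<close> by simp
  qed
  moreover have "p j + s * q j = 0" using jI by (simp add: s_def)
  ultimately show ?thesis using jI pj by (metis less_irrefl)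
qed

section \<open>Degrees and the fractional matching polytope\<close>

lemma sum_deg:
  assumes "finite H" "finite X"
  shows "(\<Sum>v\<in>X. deg H f v) = (\<Sum>e\<in>H. f e * real (card (e \<inter> X)))"
proof -
  have "(\<Sum>v\<in>X. deg H f v) = (\<Sum>v\<in>X. \<Sum>e\<in>H. if v \<in> e then f e else 0)"
    unfolding deg_def using assms by (intro sum.cong refl sum.inter_filter)
  also have "\<dots> = (\<Sum>e\<in>H. \<Sum>v\<in>X. if v \<in> e then f e else 0)" by (rule sum.swap)
  also have "\<dots> = (\<Sum>e\<in>H. \<Sum>v\<in>{v\<in>X. v \<in> e}. f e)"
    using assms by (intro sum.cong refl sum.inter_filter[symmetric])
  also have "\<dots> = (\<Sum>e\<in>H. f e * real (card (e \<inter> X)))"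
    by (intro sum.cong refl) (simp add: Int_def conj_commute mult.commute)
  finally show ?thesis .
qed

lemma deg_add_scale: "deg H (\<lambda>e. f e + s * g e) v = deg H f v + s * deg H g v"
  by (simp add: deg_def sum.distrib sum_distrib_left)

lemma deg_mono:
  assumes "finite H" "H' \<subseteq> H" "\<And>e. e \<in> H \<Longrightarrow> 0 \<le> f e"
  shows "deg H' f v \<le> deg H f v"
  unfolding deg_def using assms by (intro sum_mono2) auto

text \<open>The nonnegativity and the degree constraints are indexed by one sum type, so that moving in a
  direction until the first constraint becomes tight treats both kinds alike.\<close>

fun slack :: "'a set set \<Rightarrow> ('a set \<Rightarrow> real) \<Rightarrow> 'a set + 'a \<Rightarrow> real" where
  "slack H f (Inl e) = f e"
| "slack H f (Inr v) = 1 - deg H f v"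

definition fractional_matching :: "'a set set \<Rightarrow> ('a set \<Rightarrow> real) \<Rightarrow> bool" where
  "fractional_matching H f \<longleftrightarrow> (\<forall>i \<in> H <+> \<Union>H. 0 \<le> slack H f i)"

text \<open>Its cardinality is the quantity to be minimised: a minimiser among the fractional
  matchings of at least a given weight takes the place of a vertex of the polytope.\<close>

definition nonzero_slacks :: "'a set set \<Rightarrow> ('a set \<Rightarrow> real) \<Rightarrow> ('a set + 'a) set" where
  "nonzero_slacks H f = {i \<in> H <+> \<Union>H. slack H f i \<noteq> 0}"

lemma fractional_matching_iff:
  "fractional_matching H f \<longleftrightarrow> (\<forall>e\<in>H. 0 \<le> f e) \<and> (\<forall>v\<in>\<Union>H. deg H f v \<le> 1)"
  unfolding fractional_matching_def by (force simp: Plus_def)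

text \<open>Move from \<open>f\<close> along \<open>g\<close> until the first nonzero slack
  vanishes. By \<open>g0\<close> and \<open>d0\<close> zero slacks stay zero, and the weight does
  not drop because \<open>g\<close> has nonnegative total.\<close>

lemma fractional_matching_shift:
  assumes fin: "finite H" "\<And>e. e \<in> H \<Longrightarrow> finite e" "{} \<notin> H"
    and f: "fractional_matching H f"
    and g: "e0 \<in> H" "g e0 \<noteq> 0" "0 \<le> (\<Sum>e\<in>H. g e)"
    and g0: "\<And>e. e \<in> H \<Longrightarrow> f e = 0 \<Longrightarrow> g e = 0"
    and d0: "\<And>v. v \<in> \<Union>H \<Longrightarrow> deg H f v = 1 \<Longrightarrow> deg H g v = 0"
  shows "\<exists>f'. fractional_matching H f' \<and> (\<Sum>e\<in>H. f e) \<le> (\<Sum>e\<in>H. f' e) \<and>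
              card (nonzero_slacks H f') < card (nonzero_slacks H f)"
proof -
  define I where "I = H <+> \<Union>H"
  define q where "q i = (case i of Inl e \<Rightarrow> g e | Inr v \<Rightarrow> - deg H g v)" for i
  have finI: "finite I" using fin by (auto simp: I_def)
  have shift: "slack H (\<lambda>e. f e + s * g e) i = slack H f i + s * q i" for s i
    by (cases i) (auto simp: q_def deg_add_scale)
  have pq: "q i = 0" if "i \<in> I" "slack H f i = 0" for i
    using that g0 d0 by (fastforce simp: I_def q_def)
  have "\<exists>i\<in>I. q i < 0"
  proof (cases "\<exists>e\<in>H. g e < 0")
    case True
    then show ?thesis by (force simp: I_def q_def)
  next
    case False
    \<comment> \<open>With \<open>g\<close> nonnegative, the degree at any vertex of
      \<open>e0\<close> grows, so the constraint there bounds the move.\<close>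
    obtain v where v: "v \<in> e0" using g fin by fastforce
    have "0 < deg H g v"
      unfolding deg_def using False g v fin by (intro sum_pos2[of _ e0]) force+
    then show ?thesis using v g by (intro bexI[of _ "Inr v"]) (auto simp: I_def q_def)
  qed
  then obtain s where s: "s > 0" "\<forall>i\<in>I. 0 \<le> slack H f i + s * q i"
    "\<exists>i\<in>I. slack H f i \<noteq> 0 \<and> slack H f i + s * q i = 0"
    using first_vanishing_coordinate[OF finI, of "slack H f" q] f pq
    by (auto simp: fractional_matching_def I_def)
  define f' where "f' = (\<lambda>e. f e + s * g e)"
  have "fractional_matching H f'"
    using s(2) by (simp add: fractional_matching_def f'_def shift I_def)
  moreover have "(\<Sum>e\<in>H. f e) \<le> (\<Sum>e\<in>H. f' e)"
    using s g by (simp add: f'_def sum.distrib sum_distrib_left[symmetric])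
  moreover have "nonzero_slacks H f' \<subset> nonzero_slacks H f"
    using s(3) pq by (auto simp: nonzero_slacks_def f'_def shift I_def[symmetric])
  then have "card (nonzero_slacks H f') < card (nonzero_slacks H f)"
    using finI by (intro psubset_card_mono) (auto simp: nonzero_slacks_def I_def)
  ultimately show ?thesis by blast
qed

section \<open>Existence of an edge with a light neighbourhood\<close>

text \<open>The unknowns are the values of \<open>g\<close> on \<open>S\<close>, with one equation
  per vertex of \<open>T\<close>. If there are fewer equations than unknowns, counting suffices; if
  equally many, \<open>eq\<close> makes one equation redundant.\<close>

lemma null_direction:
  fixes S :: "'a set set"
  assumes fin: "finite H" "finite T" and S: "S \<subseteq> H" "S \<noteq> {}"
    and A: "\<And>e. e \<in> H \<Longrightarrow> card (e \<inter> A) = 1" and B: "\<And>e. e \<in> H \<Longrightarrow> card (e \<inter> B) = 1"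
    and AB: "A \<inter> B = {}"
    and le: "card T \<le> card S" and eq: "card T = card S \<Longrightarrow> \<Union>S \<subseteq> T"
  shows "\<exists>g. (\<exists>e\<in>S. g e \<noteq> 0) \<and> (\<forall>e. e \<notin> S \<longrightarrow> g e = 0) \<and> (\<forall>v\<in>T. deg H g v = 0)"
proof -
  have finS: "finite S" using S fin finite_subset by blast
  have solve: "\<exists>g. (\<exists>e\<in>S. g e \<noteq> 0) \<and> (\<forall>e. e \<notin> S \<longrightarrow> g e = 0) \<and> (\<forall>v\<in>T'. deg H g v = 0)"
    if T': "finite T'" "card T' < card S" for T' :: "'a set"
  proof -
    obtain g :: "'a set \<Rightarrow> real" where g: "\<exists>e\<in>S. g e \<noteq> 0"
        "\<forall>v\<in>T'. (\<Sum>e\<in>S. of_bool (v \<in> e) * g e) = 0"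
      using homogeneous_system_nontrivial_solution[OF T'(1) finS T'(2),
          of "\<lambda>v e. of_bool (v \<in> e) :: real"] by blast
    define h where "h e = (if e \<in> S then g e else 0)" for e
    have "deg H h v = (\<Sum>e\<in>S. of_bool (v \<in> e) * g e)" for v
    proof -
      have "deg H h v = (\<Sum>e\<in>H. if v \<in> e then h e else 0)"
        unfolding deg_def using fin by (intro sum.inter_filter)
      also have "\<dots> = (\<Sum>e\<in>S. of_bool (v \<in> e) * g e)"
        using fin S by (intro sum.mono_neutral_cong_right) (auto simp: h_def)
      finally show ?thesis .
    qed
    then show ?thesis using g by (intro exI[of _ h]) (auto simp: h_def)
  qed
  show ?thesis
  proof (cases "card T = card S")
    case False
    then show ?thesis using solve[of T] le fin by simp
  next
    case True
    obtain e v0 where e: "e \<in> S" "v0 \<in> e" "v0 \<in> A"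
      using A S by (metis Int_iff card_1_singletonE ex_in_conv insertI1 subsetD)
    have v0: "v0 \<in> T" using e eq True by blast
    then obtain g where g: "\<exists>e\<in>S. g e \<noteq> 0" "\<forall>e. e \<notin> S \<longrightarrow> g e = 0"
        "\<forall>v\<in>T - {v0}. deg H g v = 0"
      using solve[of "T - {v0}"] fin True by (metis card_Diff1_less finite_Diff)
    \<comment> \<open>The equation at \<open>v0\<close> is implied by the others: summing the degrees over either of the
      two sides \<open>A\<close>, \<open>B\<close> gives the total weight.\<close>
    have side: "(\<Sum>v\<in>T \<inter> X. deg H g v) = (\<Sum>e\<in>H. g e)"
      if "\<And>e. e \<in> H \<Longrightarrow> card (e \<inter> X) = 1" for X
    proof -
      have "(\<Sum>v\<in>T \<inter> X. deg H g v) = (\<Sum>e\<in>H. g e * real (card (e \<inter> (T \<inter> X))))"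
        using fin by (intro sum_deg) auto
      also have "\<dots> = (\<Sum>e\<in>H. g e)"
      proof (intro sum.cong refl)
        fix e assume e: "e \<in> H"
        show "g e * real (card (e \<inter> (T \<inter> X))) = g e"
        proof (cases "e \<in> S")
          case True
          then have "e \<inter> (T \<inter> X) = e \<inter> X" using eq \<open>card T = card S\<close> by blast
          then show ?thesis using that[OF e] by simp
        qed (use g in auto)
      qed
      finally show ?thesis .
    qed
    \<comment> \<open>As \<open>v0\<close> lies in \<open>A\<close>, no equation over
      \<open>B\<close> was dropped, so the total weight of \<open>g\<close> is zero.\<close>
    have "(\<Sum>v\<in>T \<inter> B. deg H g v) = 0"
      using g(3) e AB by (intro sum.neutral) auto
    moreover have "(\<Sum>v\<in>T \<inter> A. deg H g v) = deg H g v0 + (\<Sum>v\<in>T \<inter> A - {v0}. deg H g v)"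
      using fin v0 e by (intro sum.remove) auto
    moreover have "(\<Sum>v\<in>T \<inter> A - {v0}. deg H g v) = 0"
      using g(3) by (intro sum.neutral) auto
    ultimately have "deg H g v0 = 0" using side[OF A] side[OF B] by simp
    then have "\<forall>v\<in>T. deg H g v = 0" using g(3) by auto
    then show ?thesis using g by blast
  qed
qed

text \<open>Extremality of \<open>f\<close> enters only through \<open>least\<close>: a null
  direction on the support that keeps saturated degrees fixed would lead to fewer nonzero slacks at
  no loss of weight.\<close>

lemma light_neighbourhood_edge:
  fixes H :: "'a set set"
  assumes fin: "finite H" and k: "\<And>e. e \<in> H \<Longrightarrow> finite e \<and> card e = k"
    and A: "\<And>e. e \<in> H \<Longrightarrow> card (e \<inter> A) = 1" and B: "\<And>e. e \<in> H \<Longrightarrow> card (e \<inter> B) = 1"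
    and AB: "A \<inter> B = {}"
    and f: "fractional_matching H f" and nz: "\<exists>e\<in>H. f e \<noteq> 0"
    and least: "\<And>f'. fractional_matching H f' \<Longrightarrow> (\<Sum>e\<in>H. f e) \<le> (\<Sum>e\<in>H. f' e) \<Longrightarrow>
                  card (nonzero_slacks H f) \<le> card (nonzero_slacks H f')"
  shows "\<exists>e\<in>H. (\<Sum>e'\<in>{e'\<in>H. e' \<inter> e \<noteq> {}}. f e') \<le> real k - 1"
proof (rule ccontr)
  assume "\<not> ?thesis"
  then have heavy: "real k - 1 < (\<Sum>e'\<in>{e'\<in>H. e' \<inter> e \<noteq> {}}. f e')" if "e \<in> H" for e
    using that by force
  have f0: "0 \<le> f e" if "e \<in> H" for e using f that by (auto simp: fractional_matching_iff)
  have f1: "deg H f v \<le> 1" if "v \<in> \<Union>H" for v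
    using f that unfolding fractional_matching_iff by blast
  have ne: "{} \<notin> H" using A by fastforce
  have kpos: "k > 0" using nz k ne by (metis card_gt_0_iff)
  define S where "S = {e\<in>H. f e \<noteq> 0}"
  define T where "T = {v\<in>\<Union>H. deg H f v = 1}"
  have finS: "finite S" and finT: "finite T" using fin k by (auto simp: S_def T_def)
  \<comment> \<open>The degrees over \<open>e\<close> sum to at most \<open>k\<close>; this sum
    counts \<open>f e\<close> exactly \<open>k\<close> times and every other edge meeting
    \<open>e\<close> at least once. Compare with \<open>heavy\<close>.\<close>
  have light: "(real k - 1) * f e < 1" if e: "e \<in> H" for e
  proof -
    define N where "N = {e'\<in>H. e' \<inter> e \<noteq> {}}"
    have eN: "e \<in> N" "finite N" using e ne fin by (auto simp: N_def)
    have "(\<Sum>e'\<in>N. f e') + (real k - 1) * f e = real k * f e + (\<Sum>e'\<in>N - {e}. f e')"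
      using eN by (simp add: sum.remove[of N e] algebra_simps)
    also have "\<dots> \<le> real k * f e + (\<Sum>e'\<in>N - {e}. f e' * real (card (e' \<inter> e)))"
    proof (intro add_left_mono sum_mono)
      fix e' assume "e' \<in> N - {e}"
      then have "e' \<in> H" "e' \<inter> e \<noteq> {}" by (auto simp: N_def)
      then have "1 \<le> real (card (e' \<inter> e))" using k by (simp add: Suc_le_eq card_gt_0_iff)
      then show "f e' \<le> f e' * real (card (e' \<inter> e))"
        using mult_left_mono[OF _ f0[OF \<open>e' \<in> H\<close>], of 1] by simp
    qed
    also have "\<dots> = (\<Sum>e'\<in>N. f e' * real (card (e' \<inter> e)))"
      using eN k[OF e] by (simp add: sum.remove[of N e])
    also have "\<dots> = (\<Sum>e'\<in>H. f e' * real (card (e' \<inter> e)))"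
      using fin by (intro sum.mono_neutral_left) (auto simp: N_def)
    also have "\<dots> = (\<Sum>v\<in>e. deg H f v)" using fin k[OF e] by (simp add: sum_deg)
    also have "\<dots> \<le> (\<Sum>v\<in>e. 1)" using f1 e by (intro sum_mono) auto
    also have "\<dots> = real k" using k[OF e] by simp
    finally show ?thesis using heavy[OF e] by (simp add: N_def)
  qed
  \<comment> \<open>The indicator of the support, so that \<open>deg H w v\<close> is the number of
    support edges at \<open>v\<close>.\<close>
  define w where "w e = (if e \<in> S then 1 else 0 :: real)" for e
  have many: "real k \<le> deg H w v" if v: "v \<in> T" for v
  proof -
    define D where "D = {e\<in>S. v \<in> e}"
    have D: "finite D" using finS by (simp add: D_def)
    have "deg H f v = (\<Sum>e\<in>D. f e)"
      unfolding deg_def using fin by (intro sum.mono_neutral_right) (auto simp: D_def S_def)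
    then have s1: "(\<Sum>e\<in>D. f e) = 1" using v by (simp add: T_def)
    then have "D \<noteq> {}" by auto
    have "real k - 1 = (\<Sum>e\<in>D. (real k - 1) * f e)"
      using s1 by (simp add: sum_distrib_left[symmetric])
    also have "\<dots> < (\<Sum>e\<in>D. 1)"
      using D \<open>D \<noteq> {}\<close> light by (intro sum_strict_mono) (auto simp: D_def S_def)
    \<comment> \<open>More than \<open>k - 1\<close> edges means at least \<open>k\<close>, by
      integrality.\<close>
    finally have "real k \<le> real (card D)" by simp
    also have "real (card D) = (\<Sum>e\<in>D. w e)" by (simp add: w_def D_def)
    also have "\<dots> = deg H w v"
      unfolding deg_def using fin by (intro sum.mono_neutral_left) (auto simp: D_def S_def w_def)
    finally show ?thesis .
  qed
  \<comment> \<open>Double counting of incidences between \<open>T\<close> and \<open>S\<close>: at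
    least \<open>k\<close> per vertex, at most \<open>k\<close> per edge.\<close>
  have "real k * real (card T) \<le> (\<Sum>v\<in>T. deg H w v)"
    using sum_mono[of T "\<lambda>_. real k", OF many] by (simp add: mult.commute)
  also have "\<dots> = (\<Sum>e\<in>H. w e * real (card (e \<inter> T)))" using fin finT by (rule sum_deg)
  also have "\<dots> = (\<Sum>e\<in>S. real (card (e \<inter> T)))"
    using fin by (intro sum.mono_neutral_cong_right) (auto simp: w_def S_def)
  finally have lower: "real k * real (card T) \<le> (\<Sum>e\<in>S. real (card (e \<inter> T)))" .
  have cardle: "real (card (e \<inter> T)) \<le> real k" if "e \<in> S" for e
    using k[of e] that card_mono[of e "e \<inter> T"] by (auto simp: S_def)
  have upper: "(\<Sum>e\<in>S. real (card (e \<inter> T))) \<le> real k * real (card S)"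
    using sum_mono[of S _ "\<lambda>_. real k", OF cardle] by (simp add: mult.commute)
  have "real k * real (card T) \<le> real k * real (card S)" using lower upper by linarith
  then have "card T \<le> card S" using kpos by simp
  \<comment> \<open>Equality in the double count forces all \<open>k\<close> vertices of each
    support edge to be saturated.\<close>
  moreover have "\<Union>S \<subseteq> T" if eq: "card T = card S"
  proof -
    have "(\<Sum>e\<in>S. real k - real (card (e \<inter> T))) \<le> 0"
      using lower eq by (simp add: sum_subtractf mult.commute)
    moreover have "0 \<le> (\<Sum>e\<in>S. real k - real (card (e \<inter> T)))"
      using cardle by (intro sum_nonneg) auto
    ultimately have "(\<Sum>e\<in>S. real k - real (card (e \<inter> T))) = 0" by linarith
    then have full: "real k - real (card (e \<inter> T)) = 0" if "e \<in> S" for e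
      using sum_nonneg_0[OF finS _ _ that, of "\<lambda>e. real k - real (card (e \<inter> T))"] cardle by simp
    have "e \<subseteq> T" if "e \<in> S" for e
    proof -
      have "e \<in> H" using that by (simp add: S_def)
      then have "e \<inter> T = e" using full[OF that] k by (intro card_subset_eq) auto
      then show ?thesis by blast
    qed
    then show ?thesis by blast
  qed
  moreover have "S \<noteq> {}" "S \<subseteq> H" using nz by (auto simp: S_def)
  ultimately obtain g where g: "\<exists>e\<in>S. g e \<noteq> 0" "\<forall>e. e \<notin> S \<longrightarrow> g e = 0" "\<forall>v\<in>T. deg H g v = 0"
    using null_direction[OF fin finT _ _ A B AB, of S] by blast
  \<comment> \<open>The sign is chosen so that moving along \<open>g\<close> does not decrease the
    weight.\<close>
  define \<sigma> where "\<sigma> = (if 0 \<le> (\<Sum>e\<in>H. g e) then 1 else - 1 :: real)"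
  obtain e0 where e0: "e0 \<in> H" "g e0 \<noteq> 0" using g S_def by auto
  have "deg H (\<lambda>e. \<sigma> * g e) v = \<sigma> * deg H g v" for v
    by (simp add: deg_def sum_distrib_left)
  then have "\<exists>f'. fractional_matching H f' \<and> (\<Sum>e\<in>H. f e) \<le> (\<Sum>e\<in>H. f' e) \<and>
              card (nonzero_slacks H f') < card (nonzero_slacks H f)"
    using g e0 k
    by (intro fractional_matching_shift[OF fin _ ne f e0(1), of "\<lambda>e. \<sigma> * g e"])
      (auto simp: \<sigma>_def S_def T_def simp flip: sum_distrib_left)
  then show False using least by fastforce
qed

section \<open>From fractional matchings to matchings: the lower bound\<close>

text \<open>Greedy induction on the number of edges: after passing to an extremal \<open>h\<close>,
  pick a light edge and delete all edges meeting it. This costs weight at most \<open>k - 1\<close>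
  and gains one matching edge.\<close>

lemma fractional_matching_le_matching:
  fixes H :: "'a set set"
  assumes "finite H" and "\<And>e. e \<in> H \<Longrightarrow> finite e \<and> card e = k"
    and "\<And>e. e \<in> H \<Longrightarrow> card (e \<inter> A) = 1" and "\<And>e. e \<in> H \<Longrightarrow> card (e \<inter> B) = 1"
    and AB: "A \<inter> B = {}" and "fractional_matching H f"
  shows "\<exists>M. is_matching H M \<and> (\<Sum>e\<in>H. f e) \<le> (real k - 1) * real (card M)"
  using assms(1-4,6)
proof (induction "card H" arbitrary: H f rule: less_induct)
  case less
  note fin = \<open>finite H\<close>
  define P where "P h \<longleftrightarrow> fractional_matching H h \<and> (\<Sum>e\<in>H. f e) \<le> (\<Sum>e\<in>H. h e)" for h
  have "P f" using less.prems by (simp add: P_def)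
  then obtain h where h: "P h"
      "\<And>h'. P h' \<Longrightarrow> card (nonzero_slacks H h) \<le> card (nonzero_slacks H h')"
    using ex_has_least_nat[of P f "\<lambda>h. card (nonzero_slacks H h)"] by blast
  have hm: "fractional_matching H h" and hf: "(\<Sum>e\<in>H. f e) \<le> (\<Sum>e\<in>H. h e)"
    using h by (auto simp: P_def)
  show ?case
  proof (cases "\<exists>e\<in>H. h e \<noteq> 0")
    case False
    then have "(\<Sum>e\<in>H. h e) = 0" by simp
    with hf show ?thesis by (intro exI[of _ "{}"]) (auto simp: is_matching_def)
  next
    case True
    have "\<exists>e\<in>H. (\<Sum>e'\<in>{e'\<in>H. e' \<inter> e \<noteq> {}}. h e') \<le> real k - 1"
      by (rule light_neighbourhood_edge[OF fin less.prems(2-4) AB hm True])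
        (use hf h(2) in \<open>auto simp: P_def\<close>)
    then obtain e where e: "e \<in> H" and loss: "(\<Sum>e'\<in>{e'\<in>H. e' \<inter> e \<noteq> {}}. h e') \<le> real k - 1"
      by blast
    define H' where "H' = {e'\<in>H. e' \<inter> e = {}}"
    have sub: "H' \<subseteq> H" by (auto simp: H'_def)
    have "e \<noteq> {}" using less.prems(3)[OF e] by auto
    then have "H' \<subset> H" using e by (auto simp: H'_def)
    then have "card H' < card H" using fin by (rule psubset_card_mono[rotated])
    moreover have "fractional_matching H' h"
      using hm sub deg_mono[OF fin sub, of h] unfolding fractional_matching_iff
      by (meson Union_mono order_trans subsetD)
    ultimately have "\<exists>M. is_matching H' M \<and> (\<Sum>e\<in>H'. h e) \<le> (real k - 1) * real (card M)"
      using less.prems(2-4) sub finite_subset[OF sub fin] by (intro less.hyps) auto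
    then obtain M where M: "is_matching H' M"
        "(\<Sum>e\<in>H'. h e) \<le> (real k - 1) * real (card M)" by blast
    have "M \<subseteq> H'" "disjoint M" using M by (auto simp: is_matching_def)
    then have "finite M" using sub fin by (meson finite_subset)
    have "e \<notin> M" using \<open>M \<subseteq> H'\<close> \<open>e \<noteq> {}\<close> by (auto simp: H'_def)
    have "is_matching H (insert e M)"
      using \<open>M \<subseteq> H'\<close> \<open>disjoint M\<close> sub e
      by (fastforce simp: is_matching_def H'_def disjoint_def)
    moreover have "(\<Sum>e\<in>H. f e) \<le> (real k - 1) * real (card (insert e M))"
    proof -
      have "(\<Sum>e\<in>H. h e) = (\<Sum>e'\<in>H'. h e') + (\<Sum>e'\<in>{e'\<in>H. e' \<inter> e \<noteq> {}}. h e')"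
        unfolding H'_def using fin by (subst sum.union_disjoint[symmetric]) (auto intro: sum.cong)
      then show ?thesis
        using hf loss M(2) \<open>finite M\<close> \<open>e \<notin> M\<close> by (simp add: algebra_simps)
    qed
    ultimately show ?thesis by blast
  qed
qed

lemma fractionally_balanced_matching:
  assumes "fractionally_balanced [n, n, n] Vs H"
  shows "\<exists>M. is_matching H M \<and> n \<le> 2 * card M"
proof -
  have kp: "k_partite Vs H" and "map card Vs = [n, n, n]"
    using assms by (auto simp: fractionally_balanced_def)
  then obtain A B C where Vs: "Vs = [A, B, C]" and
    crd: "card A = n" "card B = n" "card C = n" by auto
  obtain f where f: "\<forall>e\<in>H. 0 \<le> f e" "\<exists>e\<in>H. f e \<noteq> 0" "balanced Vs H f"
    using assms by (auto simp: fractionally_balanced_def)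
  have finH: "finite H" and finV: "finite A" "finite B" "finite C"
    using kp by (auto simp: k_partite_def Vs)
  have dis: "A \<inter> B = {}" "A \<inter> C = {}" "B \<inter> C = {}"
    using kp by (auto simp: k_partite_def Vs disjoint_family_on_def lessThan_Suc)
  have one: "card (e \<inter> V) = 1" if "e \<in> H" "V \<in> {A, B, C}" for e V
    using kp that by (auto simp: k_partite_def Vs less_Suc_eq all_conj_distrib)
  have cov: "e \<subseteq> A \<union> B \<union> C" if "e \<in> H" for e
    using kp that by (auto simp: k_partite_def Vs)
  have edge: "finite e \<and> card e = 3" if e: "e \<in> H" for e
  proof -
    have "e = (e \<inter> A) \<union> (e \<inter> B) \<union> (e \<inter> C)" using cov[OF e] by blast
    then have "card e = card ((e \<inter> A) \<union> (e \<inter> B) \<union> (e \<inter> C))" by simp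
    also have "\<dots> = card (e \<inter> A) + card (e \<inter> B) + card (e \<inter> C)"
      using finV dis by (subst card_Un_disjoint, auto)+
    finally show ?thesis using one[OF e] cov[OF e] finV finite_subset by fastforce
  qed
  define W where "W = (\<Sum>e\<in>H. f e)"
  have W: "W > 0"
    using f finH by (metis W_def antisym_conv2 sum_nonneg sum_nonneg_eq_0_iff)
  \<comment> \<open>Summing degrees over one side counts each edge once, and by balance all
    \<open>n\<close> summands agree.\<close>
  have degW: "real n * deg H f v = W" if V: "V \<in> {A, B, C}" "v \<in> V" for V v
  proof -
    have same: "deg H f u = deg H f v" if "u \<in> V" for u
      using f(3) V that unfolding balanced_def Vs by (metis list.set(1,2))
    have "(\<Sum>u\<in>V. deg H f u) = (\<Sum>u\<in>V. deg H f v)" by (rule sum.cong[OF refl same])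
    then have "real n * deg H f v = (\<Sum>u\<in>V. deg H f u)" using V(1) crd by auto
    also have "\<dots> = (\<Sum>e\<in>H. f e * real (card (e \<inter> V)))" using finH finV V by (auto intro: sum_deg)
    also have "\<dots> = W" using one V by (simp add: W_def)
    finally show ?thesis .
  qed
  \<comment> \<open>The factor gives every vertex degree 1 and makes the total weight
    \<open>n\<close>.\<close>
  define h where "h e = real n / W * f e" for e
  have degh: "deg H h v = real n / W * deg H f v" for v
    unfolding h_def deg_def by (rule sum_distrib_left[symmetric])
  have "deg H h v \<le> 1" if "v \<in> \<Union>H" for v
  proof -
    have "v \<in> A \<union> B \<union> C" using that cov by blast
    then have "real n * deg H f v = W" using degW by blast
    then show ?thesis using W by (simp add: degh)
  qed
  then have "fractional_matching H h"
    using f W by (auto simp: fractional_matching_iff h_def)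
  then obtain M where M: "is_matching H M" "(\<Sum>e\<in>H. h e) \<le> (real 3 - 1) * real (card M)"
    using fractional_matching_le_matching[OF finH edge _ _ dis(1), of h] one by blast
  have "(\<Sum>e\<in>H. h e) = real n"
    using W unfolding h_def sum_distrib_left[symmetric] W_def[symmetric] by simp
  then have "real n \<le> 2 * real (card M)" using M(2) by simp
  then have "n \<le> 2 * card M" by linarith
  then show ?thesis using M(1) by blast
qed

section \<open>Copies of the truncated Fano plane: the upper bound\<close>

definition pasch_edge :: "nat \<Rightarrow> nat \<Rightarrow> nat \<Rightarrow> (nat \<times> nat) set" where
  "pasch_edge i j k = {(0, i), (1, j), (2, k)}"

text \<open>The indices \<open>2 q\<close> and \<open>2 q + 1\<close> of the three sides form a block carrying a truncated Fano plane
  (Pasch configuration). If \<open>n\<close> is odd, the last block is cut down to the single edge through the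
  index \<open>n - 1\<close>.\<close>

definition pasch_blocks :: "nat \<Rightarrow> (nat \<times> nat) set set" where
  "pasch_blocks n = {pasch_edge i j k | i j k. i < n \<and> j < n \<and> k < n \<and>
     i div 2 = j div 2 \<and> j div 2 = k div 2 \<and> even (i + j + k)}"

definition sides3 :: "nat \<Rightarrow> (nat \<times> nat) set list" where
  "sides3 n = map (\<lambda>t. {t} \<times> {..<n}) [0, 1, 2]"

lemma mem_pasch_edge [simp]:
  "(t, a) \<in> pasch_edge i j k \<longleftrightarrow> t = 0 \<and> a = i \<or> t = 1 \<and> a = j \<or> t = 2 \<and> a = k"
  by (auto simp: pasch_edge_def)

lemma pasch_edge_eq_iff [simp]:
  "pasch_edge i j k = pasch_edge i' j' k' \<longleftrightarrow> i = i' \<and> j = j' \<and> k = k'"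
proof
  assume eq: "pasch_edge i j k = pasch_edge i' j' k'"
  have "(0, i) \<in> pasch_edge i' j' k'" "(1, j) \<in> pasch_edge i' j' k'" "(2, k) \<in> pasch_edge i' j' k'"
    unfolding eq[symmetric] by simp_all
  then show "i = i' \<and> j = j' \<and> k = k'" by simp
qed simp

lemma k_partite_pasch_blocks: "k_partite (sides3 n) (pasch_blocks n)"
  unfolding k_partite_def
proof (intro conjI ballI allI impI)
  have "pasch_blocks n \<subseteq> Pow ({..<3} \<times> {..<n})"
    by (auto simp: pasch_blocks_def pasch_edge_def)
  then show "finite (pasch_blocks n)" by (rule finite_subset) simp
  show "finite V" if "V \<in> set (sides3 n)" for V using that by (auto simp: sides3_def)
  show "disjoint_family_on (\<lambda>t. sides3 n ! t) {..<length (sides3 n)}"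
    by (auto simp: sides3_def disjoint_family_on_def less_Suc_eq numeral_2_eq_2)
next
  fix e assume "e \<in> pasch_blocks n"
  then obtain i j k where e: "e = pasch_edge i j k" "i < n" "j < n" "k < n"
    by (auto simp: pasch_blocks_def)
  then show "e \<subseteq> \<Union>(set (sides3 n))" by (auto simp: sides3_def pasch_edge_def)
  fix t assume "t < length (sides3 n)"
  then consider "t = 0" | "t = 1" | "t = 2" by (force simp: sides3_def)
  then show "card (e \<inter> sides3 n ! t) = 1"
  proof cases
    case 1
    then have "e \<inter> sides3 n ! t = {(0, i)}" using e by (auto simp: sides3_def pasch_edge_def)
    then show ?thesis by simp
  next
    case 2
    then have "e \<inter> sides3 n ! t = {(1, j)}" using e by (auto simp: sides3_def pasch_edge_def)
    then show ?thesis by simp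
  next
    case 3
    then have "e \<inter> sides3 n ! t = {(2, k)}" using e by (auto simp: sides3_def pasch_edge_def)
    then show ?thesis by simp
  qed
qed

text \<open>In a full block each vertex lies on two of the four edges. The lone edge of a cut block
  gets weight 2 to match; it is the one through \<open>(0, n - 1)\<close> for odd
  \<open>n\<close>.\<close>

lemma deg_pasch_blocks:
  assumes "t < 3" "i < n"
  shows "deg (pasch_blocks n) (\<lambda>e. if odd n \<and> (0, n - 1) \<in> e then 2 else 1) (t, i) = 2"
    (is "deg _ ?f _ = _")
proof (cases "Suc i = n \<and> even i")
  case True
  have un: "a = i" if "a < n" "a div 2 = i div 2" for a using that True by presburger
  have "{e \<in> pasch_blocks n. (t, i) \<in> e} = {pasch_edge i i i}"
  proof (intro equalityI subsetI)
    fix e assume "e \<in> {e \<in> pasch_blocks n. (t, i) \<in> e}"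
    then obtain a b c where e: "e = pasch_edge a b c" "a < n" "b < n" "c < n"
      "a div 2 = i div 2" "b div 2 = i div 2" "c div 2 = i div 2"
      by (auto simp: pasch_blocks_def)
    then show "e \<in> {pasch_edge i i i}" using un by simp
  next
    fix e assume "e \<in> {pasch_edge i i i}"
    moreover have "pasch_edge i i i \<in> pasch_blocks n"
      unfolding pasch_blocks_def using assms True
      by (intro CollectI exI[of _ i]) simp
    ultimately show "e \<in> {e \<in> pasch_blocks n. (t, i) \<in> e}"
      using assms by auto
  qed
  then have "deg (pasch_blocks n) ?f (t, i) = ?f (pasch_edge i i i)"
    unfolding deg_def by (simp only:) simp
  moreover have "odd n" "n - 1 = i" using True by auto
  ultimately show ?thesis by simp
next
  case False
  define x where "x = 2 * (i div 2)"
  define y where "y = Suc x"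
  have i: "i = x \<or> i = y" unfolding x_def y_def by presburger
  have evx: "even x" by (simp add: x_def)
  have y: "y < n" using False assms evx i unfolding y_def by auto
  have two: "a = x \<or> a = y" if "a div 2 = i div 2" for a
    using that unfolding x_def y_def by presburger
  have dv: "x div 2 = i div 2" "y div 2 = i div 2" by (auto simp: x_def y_def)
  \<comment> \<open>Triples over \<open>{x, y}\<close> with even sum: since \<open>x\<close> is even
    and \<open>y\<close> odd, \<open>y\<close> occurs zero times or twice.\<close>
  define B where "B = {pasch_edge x x x, pasch_edge x y y, pasch_edge y x y, pasch_edge y y x}"
  have "{e \<in> pasch_blocks n. (t, i) \<in> e} = {e \<in> B. (t, i) \<in> e}"
  proof (intro equalityI subsetI)
    fix e assume e': "e \<in> {e \<in> pasch_blocks n. (t, i) \<in> e}"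
    then obtain a b c where e: "e = pasch_edge a b c" "even (a + b + c)"
      "a div 2 = i div 2" "b div 2 = i div 2" "c div 2 = i div 2"
      by (auto simp: pasch_blocks_def simp del: even_add)
    have "e \<in> B" using e(2) two[OF e(3)] two[OF e(4)] two[OF e(5)] evx
      unfolding e(1) B_def y_def by auto
    then show "e \<in> {e \<in> B. (t, i) \<in> e}" using e' by simp
  next
    fix e assume e': "e \<in> {e \<in> B. (t, i) \<in> e}"
    have "pasch_edge a b c \<in> pasch_blocks n"
      if "a \<in> {x, y}" "b \<in> {x, y}" "c \<in> {x, y}" "even (a + b + c)" for a b c
    proof -
      have "a < n" "b < n" "c < n" "a div 2 = i div 2" "b div 2 = i div 2" "c div 2 = i div 2"
        using that y dv by (auto simp: y_def)
      then show ?thesis unfolding pasch_blocks_def using that(4) by auto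
    qed
    then have "e \<in> pasch_blocks n" using e' evx by (auto simp: B_def y_def)
    then show "e \<in> {e \<in> pasch_blocks n. (t, i) \<in> e}" using e' by simp
  qed
  then have "deg (pasch_blocks n) ?f (t, i) = (\<Sum>e\<in>{e\<in>B. (t, i) \<in> e}. ?f e)"
    by (simp add: deg_def)
  also have "\<dots> = (\<Sum>e\<in>{e\<in>B. (t, i) \<in> e}. 1)"
  proof (intro sum.cong refl)
    fix e assume "e \<in> {e\<in>B. (t, i) \<in> e}"
    moreover have "odd n \<longrightarrow> n - 1 \<noteq> x \<and> n - 1 \<noteq> y" using y evx unfolding y_def by presburger
    ultimately show "?f e = 1" by (auto simp: B_def)
  qed
  also have "\<dots> = (\<Sum>e\<in>B. if (t, i) \<in> e then 1 else 0)"
    by (intro sum.inter_filter) (simp add: B_def)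
  also have "\<dots> = 2"
    using i assms(1) by (auto simp: B_def y_def less_Suc_eq numeral_3_eq_3)
  finally show ?thesis .
qed

lemma fractionally_balanced_pasch_blocks:
  assumes "n \<ge> 1"
  shows "fractionally_balanced [n, n, n] (sides3 n) (pasch_blocks n)"
proof -
  define f where "f e = (if odd n \<and> (0, n - 1) \<in> e then 2 else 1 :: real)" for e :: "(nat \<times> nat) set"
  have "deg (pasch_blocks n) f v = 2" if "V \<in> set (sides3 n)" "v \<in> V" for V v
    using that deg_pasch_blocks[of _ _ n] unfolding f_def by (auto simp: sides3_def)
  then have "balanced (sides3 n) (pasch_blocks n) f" by (simp add: balanced_def)
  moreover have "pasch_edge 0 0 0 \<in> pasch_blocks n"
    using assms unfolding pasch_blocks_def by fastforce
  moreover have "map card (sides3 n) = [n, n, n]" by (simp add: sides3_def card_cartesian_product)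
  moreover have "f e > 0" for e by (simp add: f_def)
  ultimately show ?thesis
    unfolding fractionally_balanced_def using k_partite_pasch_blocks by (metis less_imp_le less_irrefl)
qed

text \<open>Halving an index gives the number of its block, so it suffices that this map is
  injective on a matching: each block contributes at most one edge.\<close>

lemma card_matching_pasch_blocks:
  assumes "is_matching (pasch_blocks n) M"
  shows "card M \<le> (n + 1) div 2"
proof -
  have sub: "M \<subseteq> pasch_blocks n" and dis: "disjoint M" using assms by (auto simp: is_matching_def)
  have "\<exists>i j k. e = pasch_edge i j k \<and> i < n \<and> i div 2 = j div 2 \<and> j div 2 = k div 2 \<and>
      even (i + j + k)" if "e \<in> M" for e
    using subsetD[OF sub that] unfolding pasch_blocks_def by blast
  then obtain I J K where E: "\<And>e. e \<in> M \<Longrightarrow> e = pasch_edge (I e) (J e) (K e) \<and> I e < n \<and>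
      I e div 2 = J e div 2 \<and> J e div 2 = K e div 2 \<and> even (I e + J e + K e)" by metis
  \<comment> \<open>Disjoint edges in one block differ in all three coordinates, hence have opposite parities
    there, and the two coordinate sums cannot both be even.\<close>
  have "inj_on (\<lambda>e. I e div 2) M"
  proof (rule inj_onI, rule ccontr)
    fix d e assume de: "d \<in> M" "e \<in> M" "I d div 2 = I e div 2" "d \<noteq> e"
    have dj: "d \<inter> e = {}" using dis de by (auto simp: disjoint_def)
    have "(0, I d) \<in> d" "(1, J d) \<in> d" "(2, K d) \<in> d"
      by (subst E[OF de(1), THEN conjunct1], simp)+
    then have "(0, I d) \<notin> e" "(1, J d) \<notin> e" "(2, K d) \<notin> e" using dj by auto
    moreover have "(0, I e) \<in> e" "(1, J e) \<in> e" "(2, K e) \<in> e"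
      by (subst E[OF de(2), THEN conjunct1], simp)+
    ultimately have "I d \<noteq> I e" "J d \<noteq> J e" "K d \<noteq> K e" by auto
    moreover have "odd (a + b)" if "a \<noteq> b" "a div 2 = b div 2" for a b :: nat
      using that by presburger
    ultimately have "odd (I d + I e)" "odd (J d + J e)" "odd (K d + K e)"
      using E[OF de(1)] E[OF de(2)] de(3) by metis+
    moreover have "even (I d + J d + K d)" "even (I e + J e + K e)"
      using E[OF de(1)] E[OF de(2)] by blast+
    ultimately show False by simp
  qed
  moreover have "(\<lambda>e. I e div 2) ` M \<subseteq> {..<(n + 1) div 2}"
  proof
    fix q assume "q \<in> (\<lambda>e. I e div 2) ` M"
    then obtain e where "e \<in> M" "q = I e div 2" by blast
    moreover have "a div 2 < (n + 1) div 2" if "a < n" for a using that by presburger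
    ultimately show "q \<in> {..<(n + 1) div 2}" using E[of e] by blast
  qed
  ultimately show ?thesis using card_inj_on_le[of "\<lambda>e. I e div 2" M "{..<(n + 1) div 2}"] by simp
qed

theorem theorem4p3:
  fixes n :: nat
  assumes "n \<ge> 1"
  shows "int (bm [n, n, n]) = \<lceil>real n / 2\<rceil>"
proof -
  have "bm [n, n, n] = (n + 1) div 2"
    unfolding bm_def
  proof (rule Greatest_equality)
    show "\<forall>(Vs :: nat set list) H. fractionally_balanced [n, n, n] Vs H \<longrightarrow>
            (\<exists>M. is_matching H M \<and> card M = (n + 1) div 2)"
    proof (intro allI impI)
      fix Vs :: "nat set list" and H
      assume "fractionally_balanced [n, n, n] Vs H"
      then obtain M where M: "is_matching H M" "n \<le> 2 * card M"
        using fractionally_balanced_matching by blast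
      \<comment> \<open>\<open>bm\<close> asks for a matching of exactly the given size, so a larger
        one is trimmed.\<close>
      have "(n + 1) div 2 \<le> card M" using M(2) by linarith
      then obtain N where "N \<subseteq> M" "card N = (n + 1) div 2"
        by (meson obtain_subset_with_card_n)
      then show "\<exists>M. is_matching H M \<and> card M = (n + 1) div 2"
        using M(1) pairwise_subset unfolding is_matching_def by blast
    qed
  next
    fix m
    assume "\<forall>(Vs :: nat set list) H. fractionally_balanced [n, n, n] Vs H \<longrightarrow>
              (\<exists>M. is_matching H M \<and> card M = m)"
    \<comment> \<open>The vertices of the extremal hypergraph are pairs, whereas \<open>bm\<close>
      ranges over hypergraphs on \<open>nat\<close>; \<open>matching_transfer\<close> bridges the
      two.\<close>
    then obtain M where "is_matching (pasch_blocks n) M" "card M = m"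
      using matching_transfer[OF _ fractionally_balanced_pasch_blocks[OF assms], of m] by blast
    then show "m \<le> (n + 1) div 2" using card_matching_pasch_blocks by blast
  qed
  moreover have "\<lceil>real n / 2\<rceil> = int ((n + 1) div 2)"
    by (rule ceiling_unique) linarith+
  ultimately show ?thesis by simp
qed

end
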